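(* Let $t\ge 1$ be an integer, $\varepsilon>0$, $\delta\in(0,1)$, and set $$\rho=\Big(\sqrt{\log(1/\delta)+\varepsilon}-\sqrt{\log(1/\delta)}\Big)^2 .$$ Let $\mathcal{A}$ be the randomized algorithm which, on input a sequence $V=(V_1,\dots,V_t)$ of finite directed graphs, outputs $D=(D_1,\dots,D_t)$, where for each $j\in\{1,\dots,t\}$ $$D_j=\mathcal{P}\Big(\sum_{u}\deg_{V_j}(u)+Y_j\Big),\qquad Y_j\sim N\big(0,\tfrac{t}{2\rho}\big),$$ the sum running over all nodes $u$ of $V_j$, the noises $Y_1,\dots,Y_t$ being independent, and $\mathcal{P}(x)$ being the integer closest to $x$ if $x>0$ and $\mathcal{P}(x)=0$ otherwise. Then $\mathcal{A}$ is $(\varepsilon,\delta)$-edge-differentially private: for every pair of edge-neighboring inputs $V,V'$ and every set $S$ of outputs, $$\mathbb{P}(\mathcal{A}(V)\in S)\le e^{\varepsilon}\,\mathbb{P}(\mathcal{A}(V')\in S)+\delta.$$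
   Context: Graphs are finite directed graphs without multiple edges: nodes represent users of a local area network, and a directed edge from $s$ to $r$ in $V_j$ means that user $s$ sent at least one ARP request to user $r$ during week $j$. The degree $\deg_G(u)$ of a node $u$ in $G$ is its out-degree, i.e. the number of directed edges of $G$ originating from $u$. $N(\mu,\sigma^2)$ is the normal distribution with mean $\mu$ and variance $\sigma^2$, and $\log$ is the natural logarithm. In $\mathcal{P}$, ties in rounding are broken by any fixed deterministic rule. Two graphs are edge-neighboring if they differ by a single edge (same node set, and one is obtained from the other by removing exactly one directed edge). Two input sequences $V=(V_1,\dots,V_t)$ and $V'=(V'_1,\dots,V'_t)$ are edge-neighboring if for each $j$ the graphs $V_j$ and $V'_j$ are either equal or edge-neighboring. *)

theory Defs
  imports "HOL-Probability.Probability" "Graph_Theory.Pair_Digraph"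
begin

text \<open>Graphs are pair digraphs: the arcs form a set of ordered pairs of nodes, so there are no
  multiple edges. Self-loops are not excluded. A sequence \<open>V\<^sub>1, \<dots>, V\<^sub>t\<close> is a function on \<open>nat\<close>,
  of which only the values on \<open>{1..t}\<close> matter.\<close>

definition graph_sequence :: "nat \<Rightarrow> (nat \<Rightarrow> 'a pair_pre_digraph) \<Rightarrow> bool" where
  "graph_sequence t V \<longleftrightarrow> (\<forall>j\<in>{1..t}. pair_fin_digraph (V j))"

definition remove_edge :: "'a pair_pre_digraph \<Rightarrow> 'a \<times> 'a \<Rightarrow> 'a pair_pre_digraph" where
  "remove_edge G e = \<lparr>pverts = pverts G, parcs = parcs G - {e}\<rparr>"

definition edge_neighboring :: "'a pair_pre_digraph \<Rightarrow> 'a pair_pre_digraph \<Rightarrow> bool" where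
  "edge_neighboring G G' \<longleftrightarrow>
     (\<exists>e\<in>parcs G. G' = remove_edge G e) \<or> (\<exists>e\<in>parcs G'. G = remove_edge G' e)"

definition edge_neighboring_seq ::
    "nat \<Rightarrow> (nat \<Rightarrow> 'a pair_pre_digraph) \<Rightarrow> (nat \<Rightarrow> 'a pair_pre_digraph) \<Rightarrow> bool" where
  "edge_neighboring_seq t V V' \<longleftrightarrow> (\<forall>j\<in>{1..t}. V j = V' j \<or> edge_neighboring (V j) (V' j))"

text \<open>Outputs are integer sequences indexed by \<open>{1..t}\<close> (extended by \<open>undefined\<close>); a randomized
  algorithm is represented by the map sending an input to the distribution of its output.\<close>

definition outputs :: "nat \<Rightarrow> (nat \<Rightarrow> int) set" where
  "outputs t = ({1..t} \<rightarrow>\<^sub>E UNIV)"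

definition edge_differentially_private ::
    "nat \<Rightarrow> ((nat \<Rightarrow> 'a pair_pre_digraph) \<Rightarrow> (nat \<Rightarrow> int) measure) \<Rightarrow> real \<Rightarrow> real \<Rightarrow> bool" where
  "edge_differentially_private t A \<epsilon> \<delta> \<longleftrightarrow>
     (\<forall>V V'. graph_sequence t V \<longrightarrow> graph_sequence t V' \<longrightarrow> edge_neighboring_seq t V V' \<longrightarrow>
       (\<forall>S\<subseteq>outputs t. measure (A V) S \<le> exp \<epsilon> * measure (A V') S + \<delta>))"

text \<open>Ties are left open: any \<open>\<P>\<close> choosing some closest integer at each positive argument
  qualifies.\<close>

definition positive_rounding :: "(real \<Rightarrow> int) \<Rightarrow> bool" where
  "positive_rounding \<P> \<longleftrightarrow>
     (\<forall>x. (x > 0 \<longrightarrow> (\<forall>k::int. \<bar>x - of_int (\<P> x)\<bar> \<le> \<bar>x - of_int k\<bar>)) \<and>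
          (x \<le> 0 \<longrightarrow> \<P> x = 0))"

text \<open>The second parameter is the variance, whereas \<^const>\<open>normal_density\<close> takes the standard
  deviation.\<close>

definition normal_distribution :: "real \<Rightarrow> real \<Rightarrow> real measure" where
  "normal_distribution \<mu> v = density lborel (normal_density \<mu> (sqrt v))"

definition noise :: "nat \<Rightarrow> real \<Rightarrow> (nat \<Rightarrow> real) measure" where
  "noise t \<rho> = (\<Pi>\<^sub>M j\<in>{1..t}. normal_distribution 0 (real t / (2 * \<rho>)))"

definition degree_sum :: "'a pair_pre_digraph \<Rightarrow> nat" where
  "degree_sum G = (\<Sum>u\<in>pverts G. out_degree (with_proj G) u)"

definition noisy_degree_sums ::
    "(real \<Rightarrow> int) \<Rightarrow> nat \<Rightarrow> (nat \<Rightarrow> 'a pair_pre_digraph) \<Rightarrow> (nat \<Rightarrow> real) \<Rightarrow> nat \<Rightarrow> int" where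
  "noisy_degree_sums \<P> t V Y = (\<lambda>j\<in>{1..t}. \<P> (real (degree_sum (V j)) + Y j))"

text \<open>The output space is countable, so every set of outputs can be taken as measurable.\<close>

definition degree_mechanism ::
    "(real \<Rightarrow> int) \<Rightarrow> nat \<Rightarrow> real \<Rightarrow> (nat \<Rightarrow> 'a pair_pre_digraph) \<Rightarrow> (nat \<Rightarrow> int) measure" where
  "degree_mechanism \<P> t \<rho> V =
     distr (noise t \<rho>) (count_space (outputs t)) (noisy_degree_sums \<P> t V)"

text \<open>The mechanism is well defined: the map producing the output is measurable, hence
  \<^const>\<open>distr\<close> yields the actual output distribution.\<close>

lemma countable_outputs: "countable (outputs t)"
  unfolding outputs_def by (rule countable_PiE) auto

lemma positive_rounding_measurable:
  assumes "positive_rounding \<P>"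
  shows "\<P> \<in> borel \<rightarrow>\<^sub>M count_space UNIV"
proof -
  have mono: "\<P> x \<le> \<P> y" if "x < y" for x y
  proof (cases "x \<le> 0")
    case True
    have "0 \<le> \<P> y"
    proof (cases "y \<le> 0")
      case False
      then have "\<bar>y - of_int (\<P> y)\<bar> \<le> \<bar>y - of_int 0\<bar>"
        using assms unfolding positive_rounding_def by (meson not_le)
      with False show ?thesis by (auto simp: abs_if split: if_splits)
    qed (use assms in \<open>auto simp: positive_rounding_def\<close>)
    moreover have "\<P> x = 0" using True assms by (auto simp: positive_rounding_def)
    ultimately show ?thesis by simp
  next
    case False
    then have "\<bar>x - of_int (\<P> x)\<bar> \<le> \<bar>x - of_int (\<P> y)\<bar>" "\<bar>y - of_int (\<P> y)\<bar> \<le> \<bar>y - of_int (\<P> x)\<bar>"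
      using assms that unfolding positive_rounding_def by (auto simp: not_le)
    then have "real_of_int (\<P> x) \<le> real_of_int (\<P> y)" using that by (auto simp: abs_if split: if_splits)
    then show ?thesis by simp
  qed
  have "mono (\<lambda>x. real_of_int (\<P> x))"
    using mono by (auto simp: mono_def le_less)
  then have m: "(\<lambda>x. real_of_int (\<P> x)) \<in> borel_measurable borel"
    by (rule borel_measurable_mono)
  have "(\<lambda>x. \<lfloor>real_of_int (\<P> x)\<rfloor>) \<in> borel \<rightarrow>\<^sub>M count_space UNIV"
    using m by measurable
  then show ?thesis by simp
qed

lemma noisy_degree_sums_measurable:
  assumes "positive_rounding \<P>"
  shows "noisy_degree_sums \<P> t V \<in> noise t \<rho> \<rightarrow>\<^sub>M count_space (outputs t)"
proof (rule measurable_count_space_eq_countable[THEN iffD2], rule countable_outputs, intro conjI ballI)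
  have [measurable_cong]: "sets (noise t \<rho>) = sets (\<Pi>\<^sub>M j\<in>{1..t}. borel)"
    unfolding noise_def normal_distribution_def by (intro sets_PiM_cong) auto
  note [measurable] = positive_rounding_measurable[OF assms]
  show "noisy_degree_sums \<P> t V \<in> space (noise t \<rho>) \<rightarrow> outputs t"
    by (auto simp: noisy_degree_sums_def outputs_def)
  fix a assume a: "a \<in> outputs t"
  have "noisy_degree_sums \<P> t V -` {a} \<inter> space (noise t \<rho>) =
      {Y \<in> space (noise t \<rho>). \<forall>j\<in>{1..t}. \<P> (real (degree_sum (V j)) + Y j) = a j}"
    using a by (auto simp: noisy_degree_sums_def outputs_def PiE_def extensional_def fun_eq_iff)
  also have "\<dots> \<in> sets (noise t \<rho>)" by measurable
  finally show "noisy_degree_sums \<P> t V -` {a} \<inter> space (noise t \<rho>) \<in> sets (noise t \<rho>)" .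
qed

lemma prob_space_degree_mechanism:
  assumes "positive_rounding \<P>" "t \<ge> 1" "\<rho> > 0"
  shows "prob_space (degree_mechanism \<P> t \<rho> V)"
proof -
  have "prob_space (noise t \<rho>)"
    unfolding noise_def normal_distribution_def using assms
    by (intro prob_space_PiM prob_space_normal_density) auto
  then show ?thesis
    unfolding degree_mechanism_def
    by (rule prob_space.prob_space_distr) (rule noisy_degree_sums_measurable[OF assms(1)])
qed

end

theory Submission
  imports Defs
begin

text \<open>The output is a function of \<open>c + Y\<close>, where \<open>c\<close> is the vector of degree sums, and
  neighbouring inputs give vectors \<open>a\<close>, \<open>b\<close> with \<open>\<bar>a\<^sub>j - b\<^sub>j\<bar> \<le> 1\<close>. Let \<open>F\<^sub>c\<close> be the density of
  \<open>c + Y\<close> and \<open>L = ln (F\<^sub>a / F\<^sub>b)\<close>. For every \<open>\<beta> \<ge> 0\<close>, \<open>F\<^sub>a \<le> e\<^sup>\<epsilon> F\<^sub>b + e\<^bsup>\<beta> (L - \<epsilon>)\<^esup> F\<^sub>a\<close> pointwise.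
  As \<open>L\<close> is affine, \<open>e\<^bsup>\<beta> L\<^esup> F\<^sub>a\<close> is a multiple of a translated Gaussian density, of total mass
  at most \<open>e\<^bsup>\<beta> (\<beta> + 1) \<rho>\<^esup>\<close>. The choice \<open>\<beta> = (\<epsilon> - \<rho>) / (2 \<rho>)\<close> minimises \<open>\<beta> (\<beta> + 1) \<rho> - \<beta> \<epsilon>\<close>,
  and the value of \<open>\<rho>\<close> is the one for which the minimum is \<open>ln \<delta>\<close>.\<close>

section \<open>Finite products of densities and of image measures\<close>

text \<open>A finite product of sigma-finite measures is determined by its values on boxes, and the
  preimage of a box under a componentwise map is again a box.\<close>

lemma PiM_distr:
  assumes "finite I" "product_sigma_finite M" "product_sigma_finite (\<lambda>i. distr (M i) (N i) (f i))"
    and f [measurable]: "\<And>i. i \<in> I \<Longrightarrow> f i \<in> measurable (M i) (N i)"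
  shows "PiM I (\<lambda>i. distr (M i) (N i) (f i)) = distr (PiM I M) (PiM I N) (\<lambda>x. \<lambda>i\<in>I. f i (x i))"
proof (rule sym, rule product_sigma_finite.PiM_eqI)
  show "sets (distr (PiM I M) (PiM I N) (\<lambda>x. \<lambda>i\<in>I. f i (x i))) =
      sets (PiM I (\<lambda>i. distr (M i) (N i) (f i)))"
    by (simp cong: sets_PiM_cong)
  have g [measurable]: "(\<lambda>x. \<lambda>i\<in>I. f i (x i)) \<in> measurable (PiM I M) (PiM I N)"
    by (intro measurable_restrict) (rule measurable_compose[OF measurable_component_singleton], auto)
  fix A assume "\<And>i. i \<in> I \<Longrightarrow> A i \<in> sets (distr (M i) (N i) (f i))"
  then have A: "\<And>i. i \<in> I \<Longrightarrow> A i \<in> sets (N i)" by simp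
  have "(\<lambda>x. \<lambda>i\<in>I. f i (x i)) -` Pi\<^sub>E I A \<inter> space (PiM I M) =
      Pi\<^sub>E I (\<lambda>i. f i -` A i \<inter> space (M i))"
    by (auto simp: space_PiM PiE_iff extensional_def)
  then have "emeasure (distr (PiM I M) (PiM I N) (\<lambda>x. \<lambda>i\<in>I. f i (x i))) (Pi\<^sub>E I A) =
      emeasure (PiM I M) (Pi\<^sub>E I (\<lambda>i. f i -` A i \<inter> space (M i)))"
    using A \<open>finite I\<close> g by (subst emeasure_distr) (auto intro!: sets_PiM_I_finite)
  also have "\<dots> = (\<Prod>i\<in>I. emeasure (M i) (f i -` A i \<inter> space (M i)))"
    using A f \<open>finite I\<close>
    by (intro product_sigma_finite.emeasure_PiM assms(2)) (auto intro: measurable_sets)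
  also have "\<dots> = (\<Prod>i\<in>I. emeasure (distr (M i) (N i) (f i)) (A i))"
    using A f by (intro prod.cong refl) (simp add: emeasure_distr)
  finally show "emeasure (distr (PiM I M) (PiM I N) (\<lambda>x. \<lambda>i\<in>I. f i (x i))) (Pi\<^sub>E I A) =
      (\<Prod>i\<in>I. emeasure (distr (M i) (N i) (f i)) (A i))" .
qed fact+

text \<open>Boxes suffice again: the indicator of a box splits into factors, and Tonelli turns the
  integral of the product into a product of integrals.\<close>

lemma PiM_density:
  assumes "finite I" "product_sigma_finite M" "product_sigma_finite (\<lambda>i. density (M i) (f i))"
    and meas: "\<And>i. i \<in> I \<Longrightarrow> f i \<in> borel_measurable (M i)"
  shows "PiM I (\<lambda>i. density (M i) (f i)) = density (PiM I M) (\<lambda>x. \<Prod>i\<in>I. f i (x i))"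
proof (rule sym, rule product_sigma_finite.PiM_eqI)
  note [measurable] = meas
  show "sets (density (PiM I M) (\<lambda>x. \<Prod>i\<in>I. f i (x i))) = sets (PiM I (\<lambda>i. density (M i) (f i)))"
    by (simp cong: sets_PiM_cong)
  fix A assume "\<And>i. i \<in> I \<Longrightarrow> A i \<in> sets (density (M i) (f i))"
  then have A [measurable]: "\<And>i. i \<in> I \<Longrightarrow> A i \<in> sets (M i)" by simp
  have [measurable]: "Pi\<^sub>E I A \<in> sets (PiM I M)"
    by (rule sets_PiM_I_finite[OF \<open>finite I\<close> A])
  have "emeasure (density (PiM I M) (\<lambda>x. \<Prod>i\<in>I. f i (x i))) (Pi\<^sub>E I A) =
      (\<integral>\<^sup>+x. (\<Prod>i\<in>I. f i (x i)) * indicator (Pi\<^sub>E I A) x \<partial>PiM I M)"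
    by (simp add: emeasure_density)
  also have "\<dots> = (\<integral>\<^sup>+x. (\<Prod>i\<in>I. f i (x i) * indicator (A i) (x i)) \<partial>PiM I M)"
  proof (rule nn_integral_cong)
    fix x assume "x \<in> space (PiM I M)"
    then have "indicator (Pi\<^sub>E I A) x = (\<Prod>i\<in>I. indicator (A i) (x i) :: ennreal)"
      using \<open>finite I\<close> by (auto simp: indicator_def space_PiM PiE_iff prod_zero_iff)
    then show "(\<Prod>i\<in>I. f i (x i)) * indicator (Pi\<^sub>E I A) x = (\<Prod>i\<in>I. f i (x i) * indicator (A i) (x i))"
      by (simp add: prod.distrib)
  qed
  also have "\<dots> = (\<Prod>i\<in>I. \<integral>\<^sup>+x. f i x * indicator (A i) x \<partial>M i)"
    by (intro product_sigma_finite.product_nn_integral_prod assms(1,2)) simp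
  also have "\<dots> = (\<Prod>i\<in>I. emeasure (density (M i) (f i)) (A i))"
    by (intro prod.cong refl) (simp add: emeasure_density)
  finally show "emeasure (density (PiM I M) (\<lambda>x. \<Prod>i\<in>I. f i (x i))) (Pi\<^sub>E I A) =
      (\<Prod>i\<in>I. emeasure (density (M i) (f i)) (A i))" .
qed fact+

section \<open>Translated Gaussian vectors\<close>

lemma distr_normal_density_translate:
  assumes "0 < \<sigma>"
  shows "distr (density lborel (normal_density \<mu> \<sigma>)) borel (\<lambda>x. a + x) =
    density lborel (normal_density (a + \<mu>) \<sigma>)"
proof -
  \<comment> \<open>The identity on the Gaussian space is a random variable with this density; the
    affine transformation rule then applies with slope 1.\<close>
  have "distributed (density lborel (normal_density \<mu> \<sigma>)) lborel (\<lambda>x. x) (normal_density \<mu> \<sigma>)"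
    by (auto simp: distributed_def intro!: measure_eqI simp: emeasure_distr)
  from prob_space.normal_density_affine[OF prob_space_normal_density[OF assms] this assms, of 1 a]
  have "distr (density lborel (normal_density \<mu> \<sigma>)) lborel (\<lambda>x. a + x) =
      density lborel (normal_density (a + \<mu>) \<sigma>)"
    by (simp add: distributed_def)
  then show ?thesis
    by (simp cong: distr_cong)
qed

lemma product_sigma_finite_normal_density:
  assumes "0 < \<sigma>"
  shows "product_sigma_finite (\<lambda>i. density lborel (normal_density (m i) \<sigma>))"
  using assms prob_space_normal_density
  by (auto simp: product_sigma_finite_def intro: prob_space_imp_sigma_finite)

lemma PiM_normal_density:
  assumes "finite I" "0 < \<sigma>"
  shows "PiM I (\<lambda>i. density lborel (normal_density (m i) \<sigma>)) =
    density (PiM I (\<lambda>i. lborel)) (\<lambda>x. ennreal (\<Prod>i\<in>I. normal_density (m i) \<sigma> (x i)))"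
proof -
  have "PiM I (\<lambda>i. density lborel (normal_density (m i) \<sigma>)) =
      density (PiM I (\<lambda>i. lborel)) (\<lambda>x. \<Prod>i\<in>I. ennreal (normal_density (m i) \<sigma> (x i)))"
    by (intro PiM_density product_sigma_finite_normal_density assms)
      (auto simp: product_sigma_finite_def sigma_finite_lborel)
  then show ?thesis by (simp add: prod_ennreal)
qed

lemma distr_PiM_normal_density_translate:
  assumes "finite I" "0 < \<sigma>"
  shows "distr (PiM I (\<lambda>i. density lborel (normal_density (m i) \<sigma>))) (PiM I (\<lambda>i. borel))
      (\<lambda>x. \<lambda>i\<in>I. c i + x i) =
    PiM I (\<lambda>i. density lborel (normal_density (c i + m i) \<sigma>))"
proof -
  note translate = distr_normal_density_translate[OF \<open>0 < \<sigma>\<close>]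
  note sigma_finite = product_sigma_finite_normal_density[OF \<open>0 < \<sigma>\<close>]
  have "PiM I (\<lambda>i. distr (density lborel (normal_density (m i) \<sigma>)) borel (\<lambda>x. c i + x)) =
      distr (PiM I (\<lambda>i. density lborel (normal_density (m i) \<sigma>))) (PiM I (\<lambda>i. borel))
        (\<lambda>x. \<lambda>i\<in>I. c i + x i)"
    \<comment> \<open>\<open>PiM_distr\<close> also asks the image factors to be sigma-finite;
      rewritten by \<open>translate\<close> they are normal again, so \<open>sigma_finite\<close>
      covers both families.\<close>
    unfolding translate
    by (rule PiM_distr[OF \<open>finite I\<close> sigma_finite, where N = "\<lambda>_. borel" and f = "\<lambda>i x. c i + x",
        unfolded translate, OF sigma_finite]) simp
  then show ?thesis unfolding translate by (rule sym)
qed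

section \<open>The privacy loss\<close>

text \<open>The privacy loss of one coordinate. The normalising constants cancel because both
  densities share \<sigma>, and the squares of \<open>x\<close> cancel as well, so the loss is
  affine in \<open>x\<close>.\<close>

definition normal_log_ratio :: "real \<Rightarrow> real \<Rightarrow> real \<Rightarrow> real \<Rightarrow> real" where
  "normal_log_ratio a b \<sigma> x = ((x - b)\<^sup>2 - (x - a)\<^sup>2) / (2 * \<sigma>\<^sup>2)"

lemma normal_density_log_ratio:
  assumes "0 < \<sigma>"
  shows "normal_density a \<sigma> x = exp (normal_log_ratio a b \<sigma> x) * normal_density b \<sigma> x"
proof -
  have "- (x - a)\<^sup>2 / (2 * \<sigma>\<^sup>2) = normal_log_ratio a b \<sigma> x + - (x - b)\<^sup>2 / (2 * \<sigma>\<^sup>2)"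
    using assms by (simp add: normal_log_ratio_def field_simps)
  then have "exp (- (x - a)\<^sup>2 / (2 * \<sigma>\<^sup>2)) =
      exp (normal_log_ratio a b \<sigma> x) * exp (- (x - b)\<^sup>2 / (2 * \<sigma>\<^sup>2))"
    by (simp only: exp_add)
  then show ?thesis
    by (simp only: normal_density_def mult.left_commute)
qed

text \<open>Completing the square: the exponential of an affine function moves the mean of a
  Gaussian and leaves a constant factor. That factor is the moment generating function at \<beta> of
  the privacy loss under mean \<open>a\<close>.\<close>

lemma normal_density_tilt:
  assumes "0 < \<sigma>"
  shows "exp (\<beta> * normal_log_ratio a b \<sigma> x) * normal_density a \<sigma> x =
    exp (\<beta> * (\<beta> + 1) * (a - b)\<^sup>2 / (2 * \<sigma>\<^sup>2)) * normal_density (a + \<beta> * (a - b)) \<sigma> x"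
proof -
  have "\<beta> * normal_log_ratio a b \<sigma> x + - (x - a)\<^sup>2 / (2 * \<sigma>\<^sup>2) =
      (\<beta> * ((x - b)\<^sup>2 - (x - a)\<^sup>2) - (x - a)\<^sup>2) / (2 * \<sigma>\<^sup>2)"
    using assms by (simp add: normal_log_ratio_def field_simps)
  also have "\<beta> * ((x - b)\<^sup>2 - (x - a)\<^sup>2) - (x - a)\<^sup>2 =
      \<beta> * (\<beta> + 1) * (a - b)\<^sup>2 - (x - (a + \<beta> * (a - b)))\<^sup>2"
    by (simp add: power2_eq_square algebra_simps)
  finally have exponents: "\<beta> * normal_log_ratio a b \<sigma> x + - (x - a)\<^sup>2 / (2 * \<sigma>\<^sup>2) =
      \<beta> * (\<beta> + 1) * (a - b)\<^sup>2 / (2 * \<sigma>\<^sup>2) + - (x - (a + \<beta> * (a - b)))\<^sup>2 / (2 * \<sigma>\<^sup>2)"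
    by (simp add: diff_divide_distrib)
  \<comment> \<open>\<open>c\<close> stands for the normalising constant common to both sides, so
    that only the exponents have to agree.\<close>
  have "exp u * (c * exp v) = exp p * (c * exp q)" if "u + v = p + q" for u v p q c :: real
    using arg_cong[OF that, of "\<lambda>z. c * exp z"] by (simp add: exp_add mult_ac)
  from this[OF exponents] show ?thesis
    unfolding normal_density_def .
qed

text \<open>Where the total loss \<open>L\<close> is at most \<epsilon>, the first summand
  dominates. Elsewhere \<open>exp (\<beta> * L - \<beta> * \<epsilon>)\<close> is at least 1, and
  tilting every coordinate turns its product with the left side into the second summand.\<close>

lemma prod_normal_density_le:
  fixes a b :: "'i \<Rightarrow> real"
  assumes "finite I" "0 < \<sigma>" "0 \<le> \<beta>"
  shows "(\<Prod>i\<in>I. normal_density (a i) \<sigma> (x i)) \<le>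
    exp \<epsilon> * (\<Prod>i\<in>I. normal_density (b i) \<sigma> (x i)) +
    exp (\<beta> * (\<beta> + 1) * (\<Sum>i\<in>I. (a i - b i)\<^sup>2) / (2 * \<sigma>\<^sup>2) - \<beta> * \<epsilon>) *
      (\<Prod>i\<in>I. normal_density (a i + \<beta> * (a i - b i)) \<sigma> (x i))"
    (is "?F \<le> exp \<epsilon> * ?G + exp (?K - \<beta> * \<epsilon>) * ?H")
proof -
  define L where "L = (\<Sum>i\<in>I. normal_log_ratio (a i) (b i) \<sigma> (x i))"
  have nonneg: "0 \<le> ?F" "0 \<le> ?G" "0 \<le> ?H" by (auto intro!: prod_nonneg)
  have F: "?F = exp L * ?G"
    unfolding L_def exp_sum[OF \<open>finite I\<close>] prod.distrib[symmetric]
    by (intro prod.cong refl normal_density_log_ratio \<open>0 < \<sigma>\<close>)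
  have "exp (\<beta> * L) * ?F =
      (\<Prod>i\<in>I. exp (\<beta> * normal_log_ratio (a i) (b i) \<sigma> (x i)) * normal_density (a i) \<sigma> (x i))"
    by (simp add: L_def sum_distrib_left exp_sum[OF \<open>finite I\<close>] prod.distrib)
  also have "\<dots> = (\<Prod>i\<in>I. exp (\<beta> * (\<beta> + 1) * (a i - b i)\<^sup>2 / (2 * \<sigma>\<^sup>2))) * ?H"
    by (simp add: normal_density_tilt[OF \<open>0 < \<sigma>\<close>] prod.distrib)
  also have "(\<Prod>i\<in>I. exp (\<beta> * (\<beta> + 1) * (a i - b i)\<^sup>2 / (2 * \<sigma>\<^sup>2))) = exp ?K"
    by (simp add: exp_sum[OF \<open>finite I\<close>, symmetric] sum_distrib_left sum_divide_distrib)
  finally have tilt: "exp (\<beta> * L) * ?F = exp ?K * ?H" .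
  show ?thesis
  proof (cases "L \<le> \<epsilon>")
    case True
    then have "?F \<le> exp \<epsilon> * ?G"
      unfolding F by (intro mult_right_mono nonneg) simp
    then show ?thesis using nonneg by (simp add: add_increasing2)
  next
    case False
    then have "1 \<le> exp (\<beta> * L - \<beta> * \<epsilon>)"
      using \<open>0 \<le> \<beta>\<close> by (simp add: mult_left_mono)
    then have "?F \<le> exp (\<beta> * L - \<beta> * \<epsilon>) * ?F"
      using mult_right_mono[OF _ nonneg(1), of 1] by simp
    also have "\<dots> = exp (?K - \<beta> * \<epsilon>) * ?H"
      using tilt by (simp add: exp_diff)
    finally show ?thesis using nonneg by (simp add: add_increasing)
  qed
qed

lemma measure_PiM_normal_density_le:
  fixes a b :: "'i \<Rightarrow> real"
  assumes "finite I" "0 < \<sigma>" "0 \<le> \<beta>" "B \<in> sets (PiM I (\<lambda>i. borel))"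
  shows "measure (PiM I (\<lambda>i. density lborel (normal_density (a i) \<sigma>))) B \<le>
    exp \<epsilon> * measure (PiM I (\<lambda>i. density lborel (normal_density (b i) \<sigma>))) B +
    exp (\<beta> * (\<beta> + 1) * (\<Sum>i\<in>I. (a i - b i)\<^sup>2) / (2 * \<sigma>\<^sup>2) - \<beta> * \<epsilon>)"
    (is "_ \<le> _ + ?k")
proof -
  define P where "P m = PiM I (\<lambda>i. density lborel (normal_density (m i) \<sigma>))" for m :: "'i \<Rightarrow> real"
  define F where "F m x = (\<Prod>i\<in>I. normal_density (m i) \<sigma> (x i))" for m :: "'i \<Rightarrow> real" and x
  define c where "c i = a i + \<beta> * (a i - b i)" for i
  define E where "E = PiM I (\<lambda>i::'i. lborel :: real measure)"
  have setsE [measurable_cong]: "sets E = sets (PiM I (\<lambda>i. borel))"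
    unfolding E_def by (intro sets_PiM_cong) auto
  have B [measurable]: "B \<in> sets E" using assms setsE by simp
  have [measurable]: "F m \<in> borel_measurable E" for m
    unfolding F_def by measurable
  have F_nonneg: "0 \<le> F m x" for m x
    unfolding F_def by (intro prod_nonneg) auto
  have prob: "prob_space (P m)" for m
    unfolding P_def by (intro prob_space_PiM prob_space_normal_density assms)
  have P: "emeasure (P m) B = (\<integral>\<^sup>+x. ennreal (F m x) * indicator B x \<partial>E)" for m
    unfolding P_def PiM_normal_density[OF assms(1,2)] F_def[symmetric] E_def[symmetric]
    by (subst emeasure_density) auto
  have "emeasure (P a) B \<le>
      (\<integral>\<^sup>+x. ennreal (exp \<epsilon>) * (ennreal (F b x) * indicator B x) +
        ennreal ?k * (ennreal (F c x) * indicator B x) \<partial>E)"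
    unfolding P
  proof (rule nn_integral_mono)
    fix x
    have "ennreal (F a x) \<le> ennreal (exp \<epsilon> * F b x + ?k * F c x)"
      using prod_normal_density_le[OF assms(1-3)] unfolding F_def c_def by (intro ennreal_leI)
    also have "\<dots> = ennreal (exp \<epsilon>) * ennreal (F b x) + ennreal ?k * ennreal (F c x)"
      by (simp add: ennreal_plus ennreal_mult' F_nonneg)
    finally show "ennreal (F a x) * indicator B x \<le>
        ennreal (exp \<epsilon>) * (ennreal (F b x) * indicator B x) +
        ennreal ?k * (ennreal (F c x) * indicator B x)"
      by (auto simp: indicator_def)
  qed
  also have "\<dots> = ennreal (exp \<epsilon>) * emeasure (P b) B + ennreal ?k * emeasure (P c) B"
    unfolding P by (simp add: nn_integral_add nn_integral_cmult)
  \<comment> \<open>The tilted measure \<open>P c\<close> is a probability measure, so bounding its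
    mass on \<open>B\<close> by 1 leaves an additive constant independent of
    \<open>B\<close>.\<close>
  also have "\<dots> \<le> ennreal (exp \<epsilon>) * emeasure (P b) B + ennreal ?k * 1"
    using prob_space.measure_le_1[OF prob] by (intro add_left_mono mult_left_mono) auto
  finally have "ennreal (measure (P a) B) \<le> ennreal (exp \<epsilon> * measure (P b) B + ?k)"
    using prob by (simp add: finite_measure.emeasure_eq_measure prob_space.finite_measure
        ennreal_plus ennreal_mult')
  then show ?thesis
    unfolding P_def by (subst (asm) ennreal_le_iff) auto
qed

section \<open>The mechanism\<close>

text \<open>The arcs are grouped by tail; each is counted exactly once because its tail is a
  node.\<close>

lemma (in pair_fin_digraph) degree_sum_eq_card_parcs: "degree_sum G = card (parcs G)"
proof -
  have "(\<Union>u\<in>pverts G. {e \<in> parcs G. fst e = u}) = parcs G"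
    using arc_fst_in_verts by force
  moreover have "card (\<Union>u\<in>pverts G. {e \<in> parcs G. fst e = u}) =
      (\<Sum>u\<in>pverts G. card {e \<in> parcs G. fst e = u})"
    using pair_finite_verts pair_finite_arcs by (intro card_UN_disjoint) auto
  ultimately show ?thesis
    by (simp add: degree_sum_def out_degree_def out_arcs_def)
qed

text \<open>The sensitivity of one week's query: the degree sum counts arcs, and one of the two
  graphs has exactly one arc more.\<close>

lemma edge_neighboring_degree_sum:
  assumes G: "pair_fin_digraph G" and H: "pair_fin_digraph H" and "edge_neighboring G H"
  shows "\<bar>real (degree_sum G) - real (degree_sum H)\<bar> = 1"
proof -
  have *: "real (card (parcs K)) = real (card (parcs (remove_edge K e))) + 1"
    if "pair_fin_digraph K" "e \<in> parcs K" for K :: "'a pair_pre_digraph" and e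
    using card.remove[OF pair_fin_digraph.pair_finite_arcs[OF that(1)] that(2)]
    by (simp add: remove_edge_def)
  show ?thesis
    using assms * unfolding edge_neighboring_def
    by (auto simp: pair_fin_digraph.degree_sum_eq_card_parcs)
qed

lemma rounding_measurable:
  assumes "positive_rounding \<P>"
  shows "(\<lambda>x. \<lambda>j\<in>{1..t}. \<P> (x j)) \<in>
    measurable (PiM {1..t} (\<lambda>j. borel)) (count_space (outputs t))"
proof -
  \<comment> \<open>Empty graphs have degree sum 0, so on them the map of the mechanism is pure
    rounding and its measurability can be reused.\<close>
  have "(\<lambda>x. \<lambda>j\<in>{1..t}. \<P> (x j)) = noisy_degree_sums \<P> t (\<lambda>_. \<lparr>pverts = {} :: 'b set, parcs = {}\<rparr>)"
    by (simp add: noisy_degree_sums_def degree_sum_def fun_eq_iff)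
  \<comment> \<open>The parameter 1 is arbitrary: only the sigma-algebra of the noise space matters
    here.\<close>
  moreover have "sets (noise t 1) = sets (PiM {1..t} (\<lambda>j. borel))"
    unfolding noise_def normal_distribution_def by (intro sets_PiM_cong) auto
  ultimately show ?thesis
    using noisy_degree_sums_measurable[OF assms] measurable_cong_sets by metis
qed

text \<open>The input now enters only through the means, and rounding is the same post-processing
  for every input, so it suffices to compare Gaussian vectors.\<close>

lemma degree_mechanism_eq_distr:
  assumes "positive_rounding \<P>" "0 < real t / (2 * \<rho>)"
  defines "\<sigma> \<equiv> sqrt (real t / (2 * \<rho>))"
  shows "degree_mechanism \<P> t \<rho> V =
    distr (PiM {1..t} (\<lambda>j. density lborel (normal_density (real (degree_sum (V j))) \<sigma>)))
      (count_space (outputs t)) (\<lambda>x. \<lambda>j\<in>{1..t}. \<P> (x j))" (is "_ = distr ?P _ ?r")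
proof -
  define d where "d j = real (degree_sum (V j))" for j
  have "0 < \<sigma>" using assms by simp
  have noise: "noise t \<rho> = PiM {1..t} (\<lambda>j. density lborel (normal_density 0 \<sigma>))"
    by (simp add: noise_def normal_distribution_def \<sigma>_def)
  have P: "?P = distr (noise t \<rho>) (PiM {1..t} (\<lambda>j. borel)) (\<lambda>x. \<lambda>j\<in>{1..t}. d j + x j)"
    unfolding noise d_def using distr_PiM_normal_density_translate[OF _ \<open>0 < \<sigma>\<close>, of "{1..t}" "\<lambda>_. 0"]
    by simp
  have shift: "(\<lambda>x. \<lambda>j\<in>{1..t}. d j + x j) \<in> measurable (noise t \<rho>) (PiM {1..t} (\<lambda>j. borel))"
    unfolding noise by measurable
  have r: "?r \<in> measurable (PiM {1..t} (\<lambda>j. borel)) (count_space (outputs t))"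
    by (rule rounding_measurable) fact
  show ?thesis
    unfolding P distr_distr[OF r shift] degree_mechanism_def
    by (intro distr_cong refl) (auto simp: noisy_degree_sums_def d_def fun_eq_iff)
qed

theorem theorem5:
  fixes t :: nat and \<epsilon> \<delta> \<rho> :: real and \<P> :: "real \<Rightarrow> int"
  assumes "t \<ge> 1" and "\<epsilon> > 0" and "0 < \<delta>" and "\<delta> < 1"
    and "\<rho> = (sqrt (ln (1 / \<delta>) + \<epsilon>) - sqrt (ln (1 / \<delta>)))\<^sup>2"
    and "positive_rounding \<P>"
  shows "edge_differentially_private t
    (degree_mechanism \<P> t \<rho> :: (nat \<Rightarrow> 'a pair_pre_digraph) \<Rightarrow> (nat \<Rightarrow> int) measure) \<epsilon> \<delta>"
proof -
  define l where "l = ln (1 / \<delta>)"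
  define \<beta> where "\<beta> = (\<epsilon> - \<rho>) / (2 * \<rho>)"
  define \<sigma> where "\<sigma> = sqrt (real t / (2 * \<rho>))"
  have l: "0 < l" using assms(3,4) by (simp add: l_def)
  have \<rho>: "0 < \<rho>" using assms(2,5) by (simp flip: l_def)
  \<comment> \<open>By the choice of \<rho>, \<open>sqrt \<rho> + sqrt l\<close> squares to
    \<open>l + \<epsilon>\<close>; this is the cross term. It gives both the sign of \<beta> and the
    optimal exponent.\<close>
  have eq: "\<epsilon> - \<rho> = 2 * sqrt \<rho> * sqrt l"
  proof -
    have "sqrt \<rho> = sqrt (l + \<epsilon>) - sqrt l"
      using assms(2,5) by (simp flip: l_def)
    then have "(sqrt \<rho> + sqrt l)\<^sup>2 = l + \<epsilon>" using l assms(2) by simp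
    then show ?thesis using \<rho> l by (simp add: power2_sum)
  qed
  then have "0 \<le> \<beta>" using \<rho> l by (simp add: \<beta>_def)
  have var: "0 < real t / (2 * \<rho>)" using assms(1) \<rho> by simp
  then have "0 < \<sigma>" by (simp add: \<sigma>_def)
  \<comment> \<open>The value of the quadratic exponent at its minimiser; \<open>eq\<close>
    identifies it with \<open>- l\<close>, which is \<open>ln \<delta>\<close>.\<close>
  have "\<beta> * (\<beta> + 1) * \<rho> - \<beta> * \<epsilon> = - ((\<epsilon> - \<rho>)\<^sup>2 / (4 * \<rho>))"
    using \<rho> by (simp add: \<beta>_def power2_eq_square field_simps)
  also have "\<dots> = - l" using \<rho> l by (simp add: eq power_mult_distrib)
  finally have opt: "exp (\<beta> * (\<beta> + 1) * \<rho> - \<beta> * \<epsilon>) = \<delta>"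
    using assms(3) by (simp add: l_def ln_div)
  show ?thesis
    unfolding edge_differentially_private_def
  proof (intro allI impI)
    fix V V' :: "nat \<Rightarrow> 'a pair_pre_digraph" and S
    assume V: "graph_sequence t V" "graph_sequence t V'" "edge_neighboring_seq t V V'"
      and S: "S \<subseteq> outputs t"
    define a b where "a j = real (degree_sum (V j))" and "b j = real (degree_sum (V' j))" for j
    define r where "r x = (\<lambda>j\<in>{1..t}. \<P> (x j))" for x :: "nat \<Rightarrow> real"
    \<comment> \<open>As \<open>r\<close> does not depend on the input, the same event
      \<open>B\<close> serves for both \<open>V\<close> and \<open>V'\<close>.\<close>
    define B where "B = r -` S \<inter> space (PiM {1..t} (\<lambda>j. borel))"
    have r: "r \<in> measurable (PiM {1..t} (\<lambda>j. borel)) (count_space (outputs t))"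
      unfolding r_def by (rule rounding_measurable) fact
    then have B: "B \<in> sets (PiM {1..t} (\<lambda>j. borel))"
      unfolding B_def using S by (auto intro: measurable_sets)
    have mech: "measure (degree_mechanism \<P> t \<rho> W) S =
        measure (PiM {1..t} (\<lambda>j. density lborel (normal_density (real (degree_sum (W j))) \<sigma>))) B"
      for W :: "nat \<Rightarrow> 'a pair_pre_digraph"
    proof -
      let ?P = "PiM {1..t} (\<lambda>j. density lborel (normal_density (real (degree_sum (W j))) \<sigma>))"
      have sets: "sets ?P = sets (PiM {1..t} (\<lambda>j. borel))"
        by (intro sets_PiM_cong) auto
      then have "r \<in> measurable ?P (count_space (outputs t))"
        using r measurable_cong_sets by blast
      then show ?thesis
        using S sets_eq_imp_space_eq[OF sets]
        unfolding degree_mechanism_eq_distr[OF assms(6) var] r_def[symmetric] \<sigma>_def[symmetric] B_def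
        by (simp add: measure_distr)
    qed
    \<comment> \<open>Equal weeks contribute 0 and neighbouring weeks 1. All \<open>t\<close> weeks
      may differ, so the squared distance of the means can reach \<open>t\<close>.\<close>
    have "(a j - b j)\<^sup>2 \<le> 1" if "j \<in> {1..t}" for j
    proof -
      have "V j = V' j \<or> \<bar>a j - b j\<bar> = 1"
        using V that edge_neighboring_degree_sum[of "V j" "V' j"]
        unfolding graph_sequence_def edge_neighboring_seq_def a_def b_def by blast
      then show ?thesis by (auto simp: abs_square_le_1 a_def b_def)
    qed
    then have "(\<Sum>j\<in>{1..t}. (a j - b j)\<^sup>2) \<le> real t"
      using sum_bounded_above[of "{1..t}" "\<lambda>j. (a j - b j)\<^sup>2" 1] by simp
    then have "\<beta> * (\<beta> + 1) * (\<Sum>j\<in>{1..t}. (a j - b j)\<^sup>2) / (2 * \<sigma>\<^sup>2) \<le>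
        \<beta> * (\<beta> + 1) * real t / (2 * \<sigma>\<^sup>2)"
      using \<open>0 \<le> \<beta>\<close> by (intro divide_right_mono mult_left_mono) auto
    \<comment> \<open>The factor \<open>t\<close> in the noise variance absorbs that distance:
      \<open>2 * \<sigma>\<^sup>2\<close> equals \<open>t / \<rho>\<close>.\<close>
    also have "\<dots> = \<beta> * (\<beta> + 1) * \<rho>"
      using assms(1) \<rho> var by (simp add: \<sigma>_def)
    finally have "exp (\<beta> * (\<beta> + 1) * (\<Sum>j\<in>{1..t}. (a j - b j)\<^sup>2) / (2 * \<sigma>\<^sup>2) - \<beta> * \<epsilon>) \<le> \<delta>"
      unfolding opt[symmetric] by simp
    with measure_PiM_normal_density_le[OF _ \<open>0 < \<sigma>\<close> \<open>0 \<le> \<beta>\<close> B, of a \<epsilon> b]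
    show "measure (degree_mechanism \<P> t \<rho> V) S \<le>
        exp \<epsilon> * measure (degree_mechanism \<P> t \<rho> V') S + \<delta>"
      unfolding mech a_def b_def by simp
  qed
qed

end
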